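(* Let $n\ge 2$, $0<\alpha<1$, $A>0$ and $z\in\mathcal{P}_\alpha$. If there is a positive $b_1$ with $$E_z\big[\exp\big(b_1\,(B^*_{\tau_\alpha})^{1-\alpha}\big)\big]<\infty,$$ then there is some positive $b_2$ for which $$E_z\Big[\exp\Big(b_2\,\tau_\alpha^{\frac{1-\alpha}{1+\alpha}}\Big)\Big]<\infty .$$ Conversely, if the second expectation is finite for some positive $b_2$, then the first expectation is finite for some positive $b_1$.
   Context: $\mathcal{P}_\alpha=\{(x,Y)\in\mathbb{R}\times\mathbb{R}^{n-1}: x>0,\ |Y|<Ax^\alpha\}$ is a parabola-shaped region in $\mathbb{R}^n$. $\{B_t:t\ge 0\}$ is $n$-dimensional Brownian motion; $P_z$ and $E_z$ are the probability and expectation associated with this motion started at $z$. $\tau_\alpha=\inf\{t>0: B_t\notin\mathcal{P}_\alpha\}$ is the exit time from $\mathcal{P}_\alpha$, and $B^*_{\tau_\alpha}=\sup\{|B_t|: 0\le t<\tau_\alpha\}$. *)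

theory Defs
  imports "HOL-Probability.Probability"
begin

text \<open>The ambient space \<open>\<real> \<times> \<real>\<^sup>n\<^sup>-\<^sup>1\<close> is \<open>real \<times> 'a\<close> with \<open>'a\<close> a Euclidean space of dimension
  \<open>n - 1\<close>, so \<open>n = DIM(real \<times> 'a) = 1 + DIM('a) \<ge> 2\<close>; the library norm on the product type is the
  Euclidean norm.\<close>

definition parabola_region :: "real \<Rightarrow> real \<Rightarrow> (real \<times> 'a::euclidean_space) set" where
  "parabola_region A \<alpha> = {(x, Y). 0 < x \<and> norm Y < A * x powr \<alpha>}"

text \<open>Only the restriction of \<open>B\<close> to times \<open>t \<ge> 0\<close> is relevant. The density in \<open>gaussian_increments\<close>
  is that of the centred normal law with covariance matrix \<open>(t - s) I\<close>.\<close>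

locale brownian_motion = prob_space M
  for M :: "'w measure" and B :: "real \<Rightarrow> 'w \<Rightarrow> 'b::euclidean_space" and z :: 'b +
  assumes measurable_at: "0 \<le> t \<Longrightarrow> B t \<in> borel_measurable M"
    and start: "AE \<omega> in M. B 0 \<omega> = z"
    and continuous_paths: "AE \<omega> in M. continuous_on {0..} (\<lambda>t. B t \<omega>)"
    and gaussian_increments: "0 \<le> s \<Longrightarrow> s < t \<Longrightarrow>
      distributed M lborel (\<lambda>\<omega>. B t \<omega> - B s \<omega>)
        (\<lambda>x. ennreal (\<Prod>b\<in>Basis. normal_density 0 (sqrt (t - s)) (x \<bullet> b)))"
    and indep_increments: "0 \<le> u 0 \<Longrightarrow> strict_mono_on {..k::nat} u \<Longrightarrow>
      indep_vars (\<lambda>_. borel) (\<lambda>i \<omega>. B (u (Suc i)) \<omega> - B (u i) \<omega>) {..<k}"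

text \<open>Both functionals act on a single path \<open>w\<close>. The exit time is \<open>\<infinity>\<close> (the infimum of the empty set)
  if the path never leaves \<open>D\<close>; the supremum may be \<open>\<infinity>\<close> as well.\<close>

definition exit_time :: "'b set \<Rightarrow> (real \<Rightarrow> 'b) \<Rightarrow> ennreal" where
  "exit_time D w = (INF t \<in> {t. 0 < t \<and> w t \<notin> D}. ennreal t)"

definition exit_max :: "'b::real_normed_vector set \<Rightarrow> (real \<Rightarrow> 'b) \<Rightarrow> ennreal" where
  "exit_max D w = (SUP t \<in> {t. 0 \<le> t \<and> ennreal t < exit_time D w}. ennreal (norm (w t)))"

text \<open>The extension of \<open>powr\<close> is the intended one only for exponents \<open>p > 0\<close>.\<close>

definition enn_powr :: "ennreal \<Rightarrow> real \<Rightarrow> ennreal" where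
  "enn_powr x p = (if x = \<infinity> then \<infinity> else ennreal (enn2real x powr p))"

definition enn_exp :: "ennreal \<Rightarrow> ennreal" where
  "enn_exp x = (if x = \<infinity> then \<infinity> else ennreal (exp (enn2real x)))"

end

theory Submission imports Defs
begin

text \<open>
  Under the relation \<open>t = R\<close> to the power \<open>1 + \<alpha>\<close> between time and displacement, the quantities
  \<open>t / (R\<^sup>\<alpha>)\<^sup>2\<close> and \<open>R\<^sup>2 / t\<close> both equal \<open>R\<close> to the power \<open>1 - \<alpha>\<close>. They govern the
  probabilities that one of the two functionals is large without the other being large.

  If \<open>B\<^sup>* \<le> R\<close> up to a time \<open>t < \<tau>\<close>, the transversal component stays in a ball of radius
  \<open>r = A R\<^sup>\<alpha>\<close>, so all increments of one transversal coordinate over consecutive periods of length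
  \<open>16 r\<^sup>2\<close> are at most \<open>2 r\<close>. By independence this has probability at most \<open>exp (- c t / r\<^sup>2)\<close>.

  If \<open>B\<^sup>* \<ge> R\<close> and \<open>\<tau> \<le> T\<close>, the path moves by about \<open>R\<close> within time \<open>T\<close>. A union bound over dyadic
  increments (chaining) gives probability at most \<open>C exp (- c R\<^sup>2 / T)\<close>; no stopping argument is needed.

  Summing over integer scales dominates one exponential functional by the other plus a sum of
  weighted indicators with finite integral.
\<close>

section \<open>Integral domination up to exceptional events\<close>

text \<open>Only \<open>h\<close> has to be measurable, because \<open>nn_integral\<close> is a supremum over simple functions
  below the integrand. This spares any measurability argument for the exit functionals.\<close>

lemma nn_integral_le_add_measurable:
  assumes h[measurable]: "h \<in> borel_measurable M"
    and le: "AE x in M. g x \<le> f x + h x"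
  shows "(\<integral>\<^sup>+x. g x \<partial>M) \<le> (\<integral>\<^sup>+x. f x \<partial>M) + (\<integral>\<^sup>+x. h x \<partial>M)"
  unfolding nn_integral_def[of M g]
proof (rule SUP_least)
  fix s assume "s \<in> {s. simple_function M s \<and> s \<le> g}"
  then have s: "simple_function M s" "s \<le> g" by auto
  have [measurable]: "s \<in> borel_measurable M"
    using s(1) by (rule borel_measurable_simple_function)
  \<comment> \<open>On \<open>ennreal\<close>,
    \<open>\<infinity> - \<infinity> = \<infinity>\<close>, which could break
    \<open>d x \<le> f x\<close>. The value 0 where \<open>h\<close> is infinite avoids this, and
    \<open>d x + h x\<close> is infinite there anyway.\<close>
  define d where "d x = (if h x = \<infinity> then 0 else s x - h x)" for x
  have [measurable]: "d \<in> borel_measurable M"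
    unfolding d_def by measurable
  have "integral\<^sup>S M s = (\<integral>\<^sup>+x. s x \<partial>M)"
    using s(1) by (simp add: nn_integral_eq_simple_integral)
  also have "\<dots> \<le> (\<integral>\<^sup>+x. d x + h x \<partial>M)"
  proof (rule nn_integral_mono)
    fix x
    show "s x \<le> d x + h x"
      unfolding d_def
      by (cases "h x \<le> s x") (auto simp: diff_add_cancel_ennreal intro: add_increasing)
  qed
  also have "\<dots> = (\<integral>\<^sup>+x. d x \<partial>M) + (\<integral>\<^sup>+x. h x \<partial>M)"
    by (rule nn_integral_add) auto
  also have "(\<integral>\<^sup>+x. d x \<partial>M) \<le> (\<integral>\<^sup>+x. f x \<partial>M)"
  proof (rule nn_integral_mono_AE)
    show "AE x in M. d x \<le> f x"
      using le
    proof eventually_elim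
      case (elim x)
      have "s x \<le> f x + h x" using s(2) elim by (auto simp: le_fun_def intro: order_trans)
      then show ?case by (simp add: d_def ennreal_minus_le_iff add.commute)
    qed
  qed
  finally show "integral\<^sup>S M s \<le> (\<integral>\<^sup>+x. f x \<partial>M) + (\<integral>\<^sup>+x. h x \<partial>M)"
    by simp
qed

text \<open>The weighted indicators integrate term by term to the summable series of
  \<open>w n * prob (G n)\<close>, so the dominating function has finite integral. Both implications
  of the theorem take this form: \<open>f\<close> is the functional assumed integrable,
  \<open>G n\<close> contains the paths on which \<open>g\<close> is too large for \<open>f\<close>
  at scale \<open>n\<close>, and \<open>w n\<close> bounds \<open>g\<close> at that scale.\<close>

lemma (in prob_space) nn_integral_finite_if_exceptional_events:
  fixes w :: "nat \<Rightarrow> real"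
  assumes G[measurable]: "\<And>n. G n \<in> events" and w: "\<And>n. 0 \<le> w n"
    and sum: "summable (\<lambda>n. w n * prob (G n))"
    and f: "(\<integral>\<^sup>+x. f x \<partial>M) < \<infinity>"
    and le: "AE x in M. g x \<le> f x + (ennreal c + (\<Sum>n. ennreal (w n) * indicator (G n) x))"
  shows "(\<integral>\<^sup>+x. g x \<partial>M) < \<infinity>"
proof -
  let ?h = "\<lambda>x. ennreal c + (\<Sum>n. ennreal (w n) * indicator (G n) x)"
  have "(\<integral>\<^sup>+x. ?h x \<partial>M) = ennreal c + (\<Sum>n. \<integral>\<^sup>+x. ennreal (w n) * indicator (G n) x \<partial>M)"
    by (subst nn_integral_add) (auto simp: nn_integral_suminf emeasure_space_1)
  also have "(\<Sum>n. \<integral>\<^sup>+x. ennreal (w n) * indicator (G n) x \<partial>M) = (\<Sum>n. ennreal (w n * prob (G n)))"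
    by (intro suminf_cong) (simp add: nn_integral_cmult_indicator emeasure_eq_measure ennreal_mult w)
  finally have *: "(\<integral>\<^sup>+x. ?h x \<partial>M) = ennreal c + (\<Sum>n. ennreal (w n * prob (G n)))" .
  have "(\<Sum>n. ennreal (w n * prob (G n))) \<noteq> top"
    using sum by (rule ennreal_suminf_neq_top) (simp add: w)
  then have "(\<integral>\<^sup>+x. ?h x \<partial>M) < \<infinity>"
    unfolding * by (simp add: less_top[symmetric])
  moreover have "(\<integral>\<^sup>+x. g x \<partial>M) \<le> (\<integral>\<^sup>+x. f x \<partial>M) + (\<integral>\<^sup>+x. ?h x \<partial>M)"
    by (rule nn_integral_le_add_measurable[OF _ le]) measurable
  ultimately show ?thesis
    using f by (simp add: order_le_less_trans)
qed

section \<open>Divergent series in \<open>ennreal\<close> and stretched exponential series\<close>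

lemma suminf_ge_term_ennreal: "(f::nat \<Rightarrow> ennreal) n \<le> (\<Sum>n. f n)"
  using sum_le_suminf[of f "{n}"] by simp

text \<open>Serves the paths on which the functional to be bounded is infinite while the other one
  is finite: they lie in all exceptional events of large index, whose weights are at least 1, so the
  bound is infinite too.\<close>

lemma suminf_ennreal_eq_top_if_eventually_ge_1:
  fixes f :: "nat \<Rightarrow> ennreal"
  assumes "\<And>n. n \<ge> N \<Longrightarrow> 1 \<le> f n"
  shows "(\<Sum>n. f n) = \<infinity>"
proof (rule ccontr)
  assume "(\<Sum>n. f n) \<noteq> \<infinity>"
  then obtain m where m: "(\<Sum>n. f n) < of_nat m"
    using ennreal_Ex_less_of_nat by (auto simp: less_top)
  have "of_nat m = (\<Sum>n\<in>{N..<N+m}. 1::ennreal)" by simp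
  also have "\<dots> \<le> sum f {N..<N+m}" by (rule sum_mono) (use assms in auto)
  also have "\<dots> \<le> (\<Sum>n. f n)" by (rule sum_le_suminf) auto
  finally show False using m by simp
qed

lemma exp_ge_power_over_fact:
  fixes x :: real
  assumes "0 \<le> x"
  shows "x ^ k / fact k \<le> exp x"
proof -
  have "(\<Sum>n\<in>{k}. x ^ n /\<^sub>R fact n) \<le> (\<Sum>n. x ^ n /\<^sub>R fact n)"
    using assms by (intro sum_le_suminf summable_exp_generic) auto
  then show ?thesis by (simp add: exp_def divide_inverse mult.commute)
qed

text \<open>One term of the exponential series, of an order \<open>k\<close> with
  \<open>p * k \<ge> 2\<close>, already dominates the summands by a multiple of the inverse
  squares.\<close>

lemma summable_exp_neg_powr:
  assumes "0 < c" "0 < p"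
  shows "summable (\<lambda>n. exp (- c * (real n + 1) powr p))"
proof (rule summable_comparison_test)
  define k where "k = nat \<lceil>2 / p\<rceil>"
  have "2 / p \<le> real k"
    unfolding k_def by linarith
  then have pk: "2 \<le> p * real k"
    using assms by (simp add: field_simps)
  have "summable (\<lambda>n. inverse (real (Suc n) ^ 2))"
    using inverse_power_summable[of 2, where ?'a=real] by (subst summable_Suc_iff) simp
  then show "summable (\<lambda>n. fact k / c ^ k * inverse (real (Suc n) ^ 2))"
    by (rule summable_mult)
  have "norm (exp (- c * (real n + 1) powr p)) \<le> fact k / c ^ k * inverse (real (Suc n) ^ 2)" for n
  proof -
    let ?y = "(real n + 1) powr p"
    have "real (Suc n) ^ 2 = (real n + 1) powr 2"
      by (simp add: powr_numeral add.commute)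
    also have "\<dots> \<le> (real n + 1) powr (p * real k)"
      using pk by (intro powr_mono) auto
    also have "\<dots> = ?y ^ k"
      by (simp add: powr_powr[symmetric] powr_realpow)
    finally have y: "real (Suc n) ^ 2 \<le> ?y ^ k" .
    have "(c * ?y) ^ k / fact k \<le> exp (c * ?y)"
      using assms by (intro exp_ge_power_over_fact) auto
    then have "c ^ k * ?y ^ k / fact k \<le> exp (c * ?y)"
      by (simp add: power_mult_distrib)
    moreover have "c ^ k * real (Suc n) ^ 2 / fact k \<le> c ^ k * ?y ^ k / fact k"
      using assms y by (intro divide_right_mono mult_left_mono) auto
    ultimately have "c ^ k * real (Suc n) ^ 2 / fact k \<le> exp (c * ?y)"
      by linarith
    then have "inverse (exp (c * ?y)) \<le> inverse (c ^ k * real (Suc n) ^ 2 / fact k)"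
      using assms by (intro le_imp_inverse_le) auto
    then show ?thesis
      by (simp add: exp_minus divide_inverse mult_ac)
  qed
  then show "\<exists>N. \<forall>n\<ge>N. norm (exp (- c * (real n + 1) powr p)) \<le> fact k / c ^ k * inverse (real (Suc n) ^ 2)"
    by blast
qed

subsection \<open>Gaussian estimates\<close>

text \<open>The exponential factor halves the Gaussian exponent, which leaves \<open>sqrt 2\<close>
  times the density with doubled variance.\<close>

lemma nn_integral_normal_density_exp_square:
  assumes "0 < \<sigma>"
  shows "(\<integral>\<^sup>+x. ennreal (normal_density 0 \<sigma> x * exp (x\<^sup>2 / (4 * \<sigma>\<^sup>2))) \<partial>lborel) = ennreal (sqrt 2)"
proof -
  have eq: "normal_density 0 \<sigma> x * exp (x\<^sup>2 / (4 * \<sigma>\<^sup>2)) = sqrt 2 * normal_density 0 (sqrt 2 * \<sigma>) x" for x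
    using assms by (simp add: normal_density_def power_mult_distrib real_sqrt_mult mult.assoc
        flip: exp_add) (simp add: field_simps)
  have "(\<integral>\<^sup>+x. ennreal (sqrt 2 * normal_density 0 (sqrt 2 * \<sigma>) x) \<partial>lborel) = ennreal (sqrt 2)"
    using assms by (subst nn_integral_eq_integral) (auto intro!: integrable_mult_right)
  then show ?thesis by (simp add: eq)
qed

text \<open>Markov's inequality for the exponential of the squared norm over
  \<open>4 * \<sigma>\<^sup>2\<close>. Its expectation factorises over the coordinates, each
  contributing \<open>sqrt 2\<close>.\<close>

lemma (in prob_space) gaussian_tail:
  fixes X :: "'a \<Rightarrow> 'b::euclidean_space"
  assumes X: "distributed M lborel X (\<lambda>x. ennreal (\<Prod>b\<in>Basis. normal_density 0 \<sigma> (x \<bullet> b)))"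
    and \<sigma>: "0 < \<sigma>" and a: "0 \<le> a"
  shows "prob {\<omega>\<in>space M. a < norm (X \<omega>)} \<le> sqrt 2 ^ DIM('b) * exp (- (a\<^sup>2 / (4 * \<sigma>\<^sup>2)))"
proof -
  have [measurable]: "X \<in> borel_measurable M"
    using distributed_measurable[OF X] by simp
  let ?k = "exp (- (a\<^sup>2 / (4 * \<sigma>\<^sup>2)))"
  have nsq: "exp ((norm x)\<^sup>2 / (4 * \<sigma>\<^sup>2)) = (\<Prod>b\<in>Basis. exp ((x \<bullet> b)\<^sup>2 / (4 * \<sigma>\<^sup>2)))" for x :: 'b
  proof -
    have "(norm x)\<^sup>2 = (\<Sum>b\<in>Basis. (x \<bullet> b)\<^sup>2)"
      unfolding power2_norm_eq_inner euclidean_inner[of x x] by (simp add: power2_eq_square)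
    then show ?thesis by (simp add: exp_sum[symmetric] sum_divide_distrib)
  qed
  have "emeasure M {\<omega>\<in>space M. a < norm (X \<omega>)}
      = (\<integral>\<^sup>+\<omega>. indicator {\<omega>\<in>space M. a < norm (X \<omega>)} \<omega> \<partial>M)"
    by simp
  also have "\<dots> \<le> (\<integral>\<^sup>+\<omega>. ennreal (?k * exp ((norm (X \<omega>))\<^sup>2 / (4 * \<sigma>\<^sup>2))) \<partial>M)"
  proof (rule nn_integral_mono)
    fix \<omega>
    have "1 \<le> ?k * exp ((norm (X \<omega>))\<^sup>2 / (4 * \<sigma>\<^sup>2))" if "a < norm (X \<omega>)"
    proof -
      have "a\<^sup>2 \<le> (norm (X \<omega>))\<^sup>2" using a that by (intro power_mono) auto
      then show ?thesis using \<sigma> by (simp add: exp_add[symmetric] divide_right_mono)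
    qed
    then show "indicator {\<omega>\<in>space M. a < norm (X \<omega>)} \<omega> \<le> ennreal (?k * exp ((norm (X \<omega>))\<^sup>2 / (4 * \<sigma>\<^sup>2)))"
      by (auto split: split_indicator)
  qed
  also have "\<dots> = (\<integral>\<^sup>+x. ennreal (\<Prod>b\<in>Basis. normal_density 0 \<sigma> (x \<bullet> b)) *
        ennreal (?k * exp ((norm x)\<^sup>2 / (4 * \<sigma>\<^sup>2))) \<partial>(lborel::'b measure))"
    by (rule distributed_nn_integral[OF X, symmetric]) measurable
  also have "\<dots> = (\<integral>\<^sup>+x. ennreal ?k *
       (\<Prod>b\<in>Basis. ennreal (normal_density 0 \<sigma> (x \<bullet> b) * exp ((x \<bullet> b)\<^sup>2 / (4 * \<sigma>\<^sup>2)))) \<partial>(lborel::'b measure))"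
  proof (rule nn_integral_cong)
    fix x :: 'b
    have "(\<Prod>b\<in>Basis. normal_density 0 \<sigma> (x \<bullet> b)) * (?k * exp ((norm x)\<^sup>2 / (4 * \<sigma>\<^sup>2)))
      = ?k * (\<Prod>b\<in>Basis. normal_density 0 \<sigma> (x \<bullet> b) * exp ((x \<bullet> b)\<^sup>2 / (4 * \<sigma>\<^sup>2)))"
      unfolding nsq prod.distrib by (simp only: mult_ac)
    then show "ennreal (\<Prod>b\<in>Basis. normal_density 0 \<sigma> (x \<bullet> b)) * ennreal (?k * exp ((norm x)\<^sup>2 / (4 * \<sigma>\<^sup>2)))
      = ennreal ?k * (\<Prod>b\<in>Basis. ennreal (normal_density 0 \<sigma> (x \<bullet> b) * exp ((x \<bullet> b)\<^sup>2 / (4 * \<sigma>\<^sup>2))))"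
      by (subst prod_ennreal) (simp_all add: prod_nonneg flip: ennreal_mult)
  qed
  also have "\<dots> = ennreal ?k *
     (\<integral>\<^sup>+x. (\<Prod>b\<in>Basis. ennreal (normal_density 0 \<sigma> (x \<bullet> b) * exp ((x \<bullet> b)\<^sup>2 / (4 * \<sigma>\<^sup>2)))) \<partial>(lborel::'b measure))"
    by (rule nn_integral_cmult) measurable
  also have "\<dots> = ennreal ?k * (\<Prod>b\<in>(Basis::'b set). ennreal (sqrt 2))"
    by (subst nn_integral_lborel_prod) (simp_all add: nn_integral_normal_density_exp_square \<sigma>)
  also have "\<dots> = ennreal (sqrt 2 ^ DIM('b) * ?k)"
    by (simp add: ennreal_power ennreal_mult[symmetric] mult.commute)
  finally show ?thesis by (simp add: emeasure_eq_measure)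
qed

text \<open>The density of one coordinate is at most \<open>1 / (2 * \<sigma>)\<close>, because
  \<open>sqrt (2 * pi) \<ge> 2\<close>, and the interval has length \<open>2 * a\<close>; the other
  coordinates integrate to 1.\<close>

lemma (in prob_space) gaussian_coordinate_small_ball:
  fixes X :: "'a \<Rightarrow> 'b::euclidean_space"
  assumes X: "distributed M lborel X (\<lambda>x. ennreal (\<Prod>b\<in>Basis. normal_density 0 \<sigma> (x \<bullet> b)))"
    and \<sigma>: "0 < \<sigma>" and a: "0 \<le> a" and e: "e \<in> Basis"
  shows "prob {\<omega>\<in>space M. \<bar>X \<omega> \<bullet> e\<bar> \<le> a} \<le> a / \<sigma>"
proof -
  have [measurable]: "X \<in> borel_measurable M"
    using distributed_measurable[OF X] by simp
  have dens: "normal_density 0 \<sigma> y \<le> 1 / (2 * \<sigma>)" for y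
  proof -
    have "2 * \<sigma> \<le> sqrt (2 * pi * \<sigma>\<^sup>2)"
      using pi_gt3 \<sigma> by (intro real_le_rsqrt) (auto simp: power_mult_distrib)
    then have "1 / sqrt (2 * pi * \<sigma>\<^sup>2) \<le> 1 / (2 * \<sigma>)"
      using \<sigma> by (intro divide_left_mono) auto
    then have "1 / sqrt (2 * pi * \<sigma>\<^sup>2) * exp (- (y - 0)\<^sup>2 / (2 * \<sigma>\<^sup>2)) \<le> 1 / (2 * \<sigma>) * 1"
      using \<sigma> by (intro mult_mono) auto
    then show ?thesis
      unfolding normal_density_def by simp
  qed
  let ?f = "\<lambda>b y. ennreal (normal_density 0 \<sigma> y) * (if b = e then indicator {-a..a} y else 1)"
  have "emeasure M {\<omega>\<in>space M. \<bar>X \<omega> \<bullet> e\<bar> \<le> a}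
      = (\<integral>\<^sup>+\<omega>. indicator {-a..a} (X \<omega> \<bullet> e) \<partial>M)"
  proof -
    have "(\<integral>\<^sup>+\<omega>. indicator {-a..a} (X \<omega> \<bullet> e) \<partial>M)
        = (\<integral>\<^sup>+\<omega>. indicator {\<omega>\<in>space M. \<bar>X \<omega> \<bullet> e\<bar> \<le> a} \<omega> \<partial>M)"
      by (intro nn_integral_cong) (auto split: split_indicator)
    then show ?thesis by simp
  qed
  also have "\<dots> = (\<integral>\<^sup>+x. ennreal (\<Prod>b\<in>Basis. normal_density 0 \<sigma> (x \<bullet> b)) * indicator {-a..a} (x \<bullet> e) \<partial>lborel)"
    by (rule distributed_nn_integral[OF X, symmetric]) measurable
  also have "\<dots> = (\<integral>\<^sup>+x. (\<Prod>b\<in>Basis. ?f b (x \<bullet> b)) \<partial>lborel)"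
    by (intro nn_integral_cong)
      (simp add: prod_ennreal prod.distrib prod.If_cases e)
  also have "\<dots> = (\<Prod>b\<in>Basis. \<integral>\<^sup>+y. ?f b y \<partial>lborel)"
    by (rule nn_integral_lborel_prod) auto
  also have "\<dots> = (\<Prod>b\<in>Basis. if b = e then \<integral>\<^sup>+y. ?f e y \<partial>lborel else 1)"
    by (intro prod.cong) (auto simp: nn_integral_eq_integral \<sigma>)
  also have "\<dots> = (\<integral>\<^sup>+y. ?f e y \<partial>lborel)"
    using e by simp
  also have "\<dots> \<le> (\<integral>\<^sup>+y. ennreal (1 / (2 * \<sigma>)) * indicator {-a..a} y \<partial>lborel)"
    by (intro nn_integral_mono) (auto split: split_indicator intro!: ennreal_leI dens)
  also have "\<dots> = ennreal (a / \<sigma>)"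
    using a \<sigma> by (subst nn_integral_cmult_indicator) (auto simp: ennreal_mult[symmetric])
  finally show ?thesis using a \<sigma> by (simp add: emeasure_eq_measure)
qed

subsection \<open>Brownian motion\<close>

lemma (in brownian_motion) increment_tail:
  assumes "0 \<le> s" "s < t" "0 \<le> a"
  shows "prob {\<omega>\<in>space M. a < norm (B t \<omega> - B s \<omega>)} \<le> sqrt 2 ^ DIM('b) * exp (- (a\<^sup>2 / (4 * (t - s))))"
  using gaussian_tail[OF gaussian_increments[OF assms(1,2)] _ assms(3)] assms by simp

section \<open>Displacement over a time interval by dyadic chaining\<close>

text \<open>Each grid point of level \<open>m + 1\<close> is reached from one of level
  \<open>m\<close> by at most one increment of level \<open>m + 1\<close>. The bounds telescope on
  the grid, and continuity carries them to all of \<open>[0, T]\<close>.\<close>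

lemma dyadic_chaining_bound:
  fixes w :: "real \<Rightarrow> 'b::real_normed_vector"
  assumes cont: "continuous_on {0..} w" and T: "0 < T"
    and step: "\<And>m i. i < 2 ^ m \<Longrightarrow> norm (w (T * real (Suc i) / 2 ^ m) - w (T * real i / 2 ^ m)) \<le> a m"
    and L: "\<And>m. (\<Sum>j\<le>m. a j) \<le> L"
    and s: "s \<in> {0..T}"
  shows "norm (w s - w 0) \<le> L"
proof -
  have a: "0 \<le> a m" for m
    using step[of 0 m] by (auto intro: order_trans[OF norm_ge_zero])
  have grid: "norm (w (T * real i / 2 ^ m) - w 0) \<le> (\<Sum>j\<le>m. a j)" if "i \<le> 2 ^ m" for m i
    using that
  proof (induction m arbitrary: i)
    case 0
    then consider "i = 0" | "i = 1" by force
    then show ?case using a[of 0] step[of 0 0] by cases auto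
  next
    case (Suc m)
    define k where "k = i div 2"
    have k: "k \<le> 2 ^ m" using Suc.prems by (simp add: k_def)
    have half: "T * real (2 * k) / 2 ^ Suc m = T * real k / 2 ^ m" by simp
    show ?case
    proof (cases "even i")
      case True
      then have "i = 2 * k" by (simp add: k_def)
      then show ?thesis
        using Suc.IH[OF k] a[of "Suc m"] half by simp
    next
      case False
      then have i: "i = Suc (2 * k)" by (simp add: k_def)
      with Suc.prems have "2 * k < 2 ^ Suc m" by simp
      from step[OF this] have
        "norm (w (T * real i / 2 ^ Suc m) - w (T * real k / 2 ^ m)) \<le> a (Suc m)"
        unfolding i half .
      moreover have "norm (w (T * real i / 2 ^ Suc m) - w 0) \<le>
          norm (w (T * real i / 2 ^ Suc m) - w (T * real k / 2 ^ m)) + norm (w (T * real k / 2 ^ m) - w 0)"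
        using norm_triangle_ineq[of "w (T * real i / 2 ^ Suc m) - w (T * real k / 2 ^ m)"
            "w (T * real k / 2 ^ m) - w 0"] by simp
      ultimately show ?thesis
        using Suc.IH[OF k] by simp
    qed
  qed
  \<comment> \<open>\<open>q m\<close> is the last grid point of level \<open>m\<close> not after
    \<open>s\<close>, so it misses \<open>s\<close> by at most \<open>T / 2 ^ m\<close>.\<close>
  define i where "i m = nat \<lfloor>s / T * 2 ^ m\<rfloor>" for m :: nat
  define q where "q m = T * real (i m) / 2 ^ m" for m
  have i: "real (i m) \<le> s / T * 2 ^ m" "s / T * 2 ^ m < real (i m) + 1" for m
    using s T unfolding i_def by (auto intro!: of_nat_floor)
  have "i m \<le> 2 ^ m" for m
  proof -
    have "s / T * 2 ^ m \<le> 1 * 2 ^ m" using s T by (intro mult_right_mono) auto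
    with i(1)[of m] have "real (i m) \<le> 2 ^ m" by linarith
    then show ?thesis by simp
  qed
  then have bound: "norm (w (q m) - w 0) \<le> L" for m
    unfolding q_def using grid L order_trans by blast
  have q: "\<bar>q m - s\<bar> \<le> T * (1 / 2) ^ m" for m
  proof -
    have "q m \<le> s"
      using i(1)[of m] T unfolding q_def by (simp add: field_simps)
    moreover have "s \<le> q m + T * (1 / 2) ^ m"
      using i(2)[of m] T unfolding q_def by (simp add: field_simps)
    ultimately show ?thesis by linarith
  qed
  have "(\<lambda>m. T * (1 / 2) ^ m) \<longlonglongrightarrow> T * 0"
    by (intro tendsto_mult tendsto_const LIMSEQ_power_zero) simp
  then have "(\<lambda>m. T * (1 / 2) ^ m) \<longlonglongrightarrow> 0"
    by simp
  then have "(\<lambda>m. q m - s) \<longlonglongrightarrow> 0"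
    by (rule Lim_null_comparison[rotated]) (simp add: q)
  then have "q \<longlonglongrightarrow> s"
    by (simp add: LIM_zero_iff)
  moreover have "0 \<le> q m" for m
    using T by (simp add: q_def)
  ultimately have "(\<lambda>m. w (q m)) \<longlonglongrightarrow> w s"
    using cont s by (intro continuous_on_tendsto_compose[OF cont]) auto
  then have "(\<lambda>m. norm (w (q m) - w 0)) \<longlonglongrightarrow> norm (w s - w 0)"
    by (intro tendsto_intros)
  then show ?thesis
    by (rule LIMSEQ_le_const2) (use bound in auto)
qed

text \<open>By Bernoulli's inequality the power of \<open>9 / 8\<close> is at least
  \<open>1 + m / 8\<close>, so \<open>x \<ge> 16\<close> yields an exponent of at least
  \<open>x + 2 * m\<close>. As \<open>exp (- 2) \<le> 1 / 4\<close>, the factor \<open>2 ^ m\<close>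
  is absorbed and \<open>(1 / 2) ^ m\<close> remains.\<close>

lemma exp_geometric_sum_le:
  fixes x :: real
  assumes "16 \<le> x"
  shows "2 ^ m * exp (- (x * (9 / 8) ^ m)) \<le> exp (- x) * (1 / 2) ^ m"
proof -
  have "1 + real m * (1 / 8) \<le> (1 + 1 / 8 :: real) ^ m"
    by (rule Bernoulli_inequality) simp
  then have "x * (1 + real m / 8) \<le> x * (9 / 8) ^ m"
    using assms by (intro mult_left_mono) auto
  moreover have "16 * (real m / 8) \<le> x * (real m / 8)"
    using assms by (intro mult_right_mono) auto
  ultimately have "x + real m * 2 \<le> x * (9 / 8) ^ m"
    by (simp add: algebra_simps)
  then have "exp (- (x * (9 / 8) ^ m)) \<le> exp (- x) * exp (- 2) ^ m"
    by (simp add: exp_of_nat_mult[symmetric] flip: exp_add)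
  moreover have "exp (- 2 :: real) ^ m \<le> (1 / 4) ^ m"
  proof (rule power_mono)
    have "2 * 2 \<le> exp 1 * exp (1::real)"
      using exp_ge_add_one_self[of 1] by (intro mult_mono) auto
    then have "4 \<le> exp (2::real)" by (simp flip: exp_add)
    then show "exp (- 2 :: real) \<le> 1 / 4" by (simp add: exp_minus field_simps)
  qed simp
  ultimately have "exp (- (x * (9 / 8) ^ m)) \<le> exp (- x) * (1 / 4) ^ m"
    by (meson exp_ge_zero mult_left_mono order_trans)
  then have "2 ^ m * exp (- (x * (9 / 8) ^ m)) \<le> 2 ^ m * (exp (- x) * (1 / 4) ^ m)"
    by (intro mult_left_mono) auto
  also have "\<dots> = exp (- x) * (2 * (1 / 4)) ^ m"
    unfolding power_mult_distrib by simp
  finally show ?thesis by simp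
qed

text \<open>\<open>E\<close> collects the dyadic increments that exceed their thresholds. Being a
  countable union of events at fixed times, it is measurable, and outside it chaining controls
  almost every path at all times up to \<open>T\<close>.\<close>

lemma (in brownian_motion) maximal_displacement_tail:
  assumes T: "0 < T" and R: "0 < R"
  shows "\<exists>E\<in>events. prob E \<le> (2 * sqrt 2 ^ DIM('b) + exp 16) * exp (- (R\<^sup>2 / (64 * T))) \<and>
    (AE \<omega> in M. \<omega> \<notin> E \<longrightarrow> (\<forall>s\<in>{0..T}. norm (B s \<omega> - z) \<le> R))"
proof (cases "16 \<le> R\<^sup>2 / (64 * T)")
  \<comment> \<open>Here the summand \<open>exp 16\<close> lifts the claimed bound to at least 1, so
    the whole space serves as \<open>E\<close>.\<close>
  case False
  then have "1 \<le> exp (16 - R\<^sup>2 / (64 * T))" by simp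
  also have "\<dots> = exp 16 * exp (- (R\<^sup>2 / (64 * T)))" by (simp flip: exp_add)
  also have "\<dots> \<le> (2 * sqrt 2 ^ DIM('b) + exp 16) * exp (- (R\<^sup>2 / (64 * T)))"
    by (intro mult_right_mono) auto
  finally show ?thesis
    by (intro bexI[of _ "space M"]) (auto simp: prob_space)
next
  case True
  define K where "K = sqrt 2 ^ DIM('b)"
  \<comment> \<open>\<open>64 = 16 * 4\<close>: the square of the factor \<open>1 / 4\<close> in the
    thresholds, times the 4 in the exponent of \<open>increment_tail\<close>.\<close>
  define x where "x = R\<^sup>2 / (64 * T)"
  \<comment> \<open>The thresholds sum to at most \<open>R\<close>, and \<open>2 * (3 / 4)\<^sup>2 = 9 / 8 > 1\<close> makes the Gaussian tails
    beat the number \<open>2 ^ m\<close> of increments.\<close>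
  define a where "a m = R / 4 * (3 / 4) ^ m" for m :: nat
  define u where "u m i = T * real i / 2 ^ m" for m i :: nat
  define D where "D m i = {\<omega>\<in>space M. a m < norm (B (u m (Suc i)) \<omega> - B (u m i) \<omega>)}" for m i
  define F where "F m = (\<Union>i<2 ^ m. D m i)" for m
  have [measurable]: "B (u m i) \<in> borel_measurable M" for m i
    using T by (intro measurable_at) (simp add: u_def)
  have D[measurable]: "D m i \<in> events" for m i
    unfolding D_def by measurable
  have F[measurable]: "F m \<in> events" for m
    unfolding F_def by measurable
  have "prob (D m i) \<le> K * exp (- (x * (9 / 8) ^ m))" for m i
  proof -
    have "u m (Suc i) - u m i = T / 2 ^ m"
      by (simp add: u_def diff_divide_distrib[symmetric] algebra_simps)
    moreover have "(a m)\<^sup>2 / (4 * (T / 2 ^ m)) = x * (9 / 8) ^ m"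
    proof -
      have "(a m)\<^sup>2 = R\<^sup>2 / 16 * ((3 / 4)\<^sup>2) ^ m"
      proof -
        have "((3 / 4 :: real) ^ m)\<^sup>2 = ((3 / 4)\<^sup>2) ^ m"
          by (metis mult.commute power_mult)
        then show ?thesis
          unfolding a_def power_mult_distrib by (simp add: power2_eq_square)
      qed
      then have "(a m)\<^sup>2 / (4 * (T / 2 ^ m)) = R\<^sup>2 / 16 * ((3 / 4)\<^sup>2) ^ m / (4 * (T / 2 ^ m))"
        by (rule arg_cong)
      also have "\<dots> = x * (((3 / 4)\<^sup>2) ^ m * 2 ^ m)"
        using T by (simp add: x_def)
      also have "((3 / 4 :: real)\<^sup>2) ^ m * 2 ^ m = ((3 / 4)\<^sup>2 * 2) ^ m"
        by (rule power_mult_distrib[symmetric])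
      also have "(3 / 4 :: real)\<^sup>2 * 2 = 9 / 8" by (simp add: power2_eq_square)
      finally show ?thesis .
    qed
    moreover have "0 \<le> u m i" "u m i < u m (Suc i)" "0 \<le> a m"
      using T R by (auto simp: u_def a_def divide_strict_right_mono)
    ultimately show ?thesis
      using increment_tail[of "u m i" "u m (Suc i)" "a m"] by (simp add: D_def K_def)
  qed
  then have "(\<Sum>i<2 ^ m. prob (D m i)) \<le> (\<Sum>i<(2::nat) ^ m. K * exp (- (x * (9 / 8) ^ m)))" for m
    by (intro sum_mono)
  then have "prob (F m) \<le> K * (2 ^ m * exp (- (x * (9 / 8) ^ m)))" for m
    unfolding F_def using finite_measure_subadditive_finite[of "{..<2 ^ m}" "D m"] D
    by (force intro: order_trans simp: mult_ac)
  moreover have "K * (2 ^ m * exp (- (x * (9 / 8) ^ m))) \<le> K * (exp (- x) * (1 / 2) ^ m)" for m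
    using exp_geometric_sum_le[of x m] True by (intro mult_left_mono) (auto simp: x_def K_def)
  ultimately have F_le: "prob (F m) \<le> K * exp (- x) * (1 / 2) ^ m" for m
    by (metis order_trans mult.assoc)
  have geo: "(\<lambda>m. K * exp (- x) * (1 / 2) ^ m) sums (K * exp (- x) * 2)"
    using sums_mult[OF geometric_sums[of "1 / 2 :: real"]] by simp
  have sF: "summable (\<lambda>m. prob (F m))"
    by (rule summable_comparison_test[OF _ sums_summable[OF geo]]) (use F_le in auto)
  have "prob (\<Union>m. F m) \<le> (\<Sum>m. prob (F m))"
    by (rule finite_measure_subadditive_countably[OF _ sF]) auto
  also have "\<dots> \<le> K * exp (- x) * 2"
    using suminf_le[OF F_le sF sums_summable[OF geo]] sums_unique[OF geo] by simp
  also have "\<dots> \<le> (2 * K + exp 16) * exp (- x)"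
    by (simp add: algebra_simps)
  finally have "prob (\<Union>m. F m) \<le> (2 * K + exp 16) * exp (- x)" .
  moreover have "AE \<omega> in M. \<omega> \<notin> (\<Union>m. F m) \<longrightarrow> (\<forall>s\<in>{0..T}. norm (B s \<omega> - z) \<le> R)"
    using start continuous_paths AE_space
  proof eventually_elim
    case (elim \<omega>)
    show ?case
    proof (intro impI ballI)
      fix s assume \<omega>: "\<omega> \<notin> (\<Union>m. F m)" and s: "s \<in> {0..T}"
      have "norm (B (T * real (Suc i) / 2 ^ m) \<omega> - B (T * real i / 2 ^ m) \<omega>) \<le> a m" if "i < 2 ^ m" for m i
        using \<omega> elim that by (auto simp: F_def D_def u_def not_less)
      moreover have "(\<Sum>j\<le>m. a j) \<le> R" for m
      proof -
        have "(\<Sum>j\<le>m. a j) = R * (1 - (3 / 4) ^ Suc m)"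
          unfolding a_def sum_distrib_left[symmetric] by (subst sum_gp0) simp
        also have "\<dots> \<le> R * 1"
          using R by (intro mult_left_mono) auto
        finally show ?thesis by simp
      qed
      ultimately have "norm (B s \<omega> - B 0 \<omega>) \<le> R"
        using elim s T by (intro dyadic_chaining_bound[of "\<lambda>t. B t \<omega>" T a R s]) auto
      then show "norm (B s \<omega> - z) \<le> R" using elim by simp
    qed
  qed
  moreover have "(\<Union>m. F m) \<in> events" by measurable
  ultimately show ?thesis
    unfolding K_def x_def by blast
qed

section \<open>Confinement of one coordinate\<close>

text \<open>Over a period of length \<open>16 * r\<^sup>2\<close> the standard deviation is
  \<open>4 * r\<close>, so the small ball estimate gives \<open>2 * r / (4 * r) = 1 / 2\<close> per
  period. Independence multiplies these.\<close>

lemma (in brownian_motion) coordinate_increments_small: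
  fixes r :: real and k :: nat and e :: 'b
  defines "S \<equiv> {\<omega>\<in>space M. \<forall>i<k. \<bar>(B (16 * r\<^sup>2 * real (Suc i)) \<omega> - B (16 * r\<^sup>2 * real i) \<omega>) \<bullet> e\<bar> \<le> 2 * r}"
  assumes r: "0 < r" and e: "e \<in> Basis"
  shows "S \<in> events" and "prob S \<le> (1 / 2) ^ k"
proof -
  define u where "u i = 16 * r\<^sup>2 * real i" for i :: nat
  define J where "J = {x :: 'b. \<bar>x \<bullet> e\<bar> \<le> 2 * r}"
  have [measurable]: "B (u i) \<in> borel_measurable M" for i
    using r by (intro measurable_at) (simp add: u_def)
  have [measurable]: "J \<in> sets borel" unfolding J_def by measurable
  have S: "S = {\<omega>\<in>space M. \<forall>i<k. B (u (Suc i)) \<omega> - B (u i) \<omega> \<in> J}"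
    by (simp add: S_def u_def J_def)
  show "S \<in> events"
    unfolding S by measurable
  have p: "prob ((\<lambda>\<omega>. B (u (Suc i)) \<omega> - B (u i) \<omega>) -` J \<inter> space M) \<le> 1 / 2" for i
  proof -
    have u: "0 \<le> u i" "u i < u (Suc i)" "sqrt (u (Suc i) - u i) = 4 * r"
      using r by (auto simp: u_def algebra_simps real_sqrt_mult)
    have "prob {\<omega>\<in>space M. \<bar>(B (u (Suc i)) \<omega> - B (u i) \<omega>) \<bullet> e\<bar> \<le> 2 * r} \<le> 2 * r / (4 * r)"
      using gaussian_coordinate_small_ball[OF gaussian_increments[OF u(1,2), unfolded u(3)] _ _ e, of "2 * r"] r
      by simp
    also have "\<dots> = 1 / 2" using r by simp
    finally show ?thesis
      by (simp add: J_def vimage_def Int_def conj_commute)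
  qed
  show "prob S \<le> (1 / 2) ^ k"
  \<comment> \<open>An intersection over the empty index set would be \<open>UNIV\<close> rather
    than \<open>space M\<close>, hence the separate case.\<close>
  proof (cases "k = 0")
    case True
    then show ?thesis by (simp add: prob_le_1)
  next
    case False
    have ind: "indep_vars (\<lambda>_. borel) (\<lambda>i \<omega>. B (u (Suc i)) \<omega> - B (u i) \<omega>) {..<k}"
      using r by (intro indep_increments) (auto simp: u_def strict_mono_on_def)
    have "prob S = prob (\<Inter>i\<in>{..<k}. (\<lambda>\<omega>. B (u (Suc i)) \<omega> - B (u i) \<omega>) -` J \<inter> space M)"
      unfolding S using False by (intro arg_cong[where f = prob]) auto
    also have "\<dots> = (\<Prod>i<k. prob ((\<lambda>\<omega>. B (u (Suc i)) \<omega> - B (u i) \<omega>) -` J \<inter> space M))"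
      using False by (intro indep_varsD_finite[OF ind]) auto
    also have "\<dots> \<le> (\<Prod>i<k. 1 / 2)"
      by (intro prod_mono) (use p in auto)
    finally show ?thesis by simp
  qed
qed

subsection \<open>Exit functionals\<close>

lemma enn_exp_mult_powr:
  assumes "0 \<le> x" "0 < b"
  shows "enn_exp (ennreal b * enn_powr (ennreal x) p) = ennreal (exp (b * x powr p))"
proof -
  have "ennreal b * enn_powr (ennreal x) p = ennreal (b * x powr p)"
    using assms by (simp add: enn_powr_def ennreal_mult)
  then show ?thesis
    using assms by (simp add: enn_exp_def)
qed

lemma enn_exp_mult_powr_top:
  assumes "0 < b"
  shows "enn_exp (ennreal b * enn_powr \<infinity> p) = \<infinity>"
  using assms by (simp add: enn_powr_def enn_exp_def ennreal_mult_eq_top_iff)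

lemma in_domain_before_exit:
  assumes "0 < t" "ennreal t < exit_time D w"
  shows "w t \<in> D"
proof (rule ccontr)
  assume "w t \<notin> D"
  then have "exit_time D w \<le> ennreal t"
    unfolding exit_time_def using assms by (intro INF_lower) auto
  then show False using assms by simp
qed

lemma norm_le_exit_max:
  assumes "0 \<le> t" "ennreal t < exit_time D w"
  shows "ennreal (norm (w t)) \<le> exit_max D w"
  unfolding exit_max_def using assms by (intro SUP_upper) auto

lemma exit_max_le:
  assumes "exit_time D w \<le> ennreal T" "\<And>s. s \<in> {0..T} \<Longrightarrow> norm (w s) \<le> L"
  shows "exit_max D w \<le> ennreal L"
  unfolding exit_max_def
proof (rule SUP_least)
  fix s assume "s \<in> {t. 0 \<le> t \<and> ennreal t < exit_time D w}"
  then have s: "0 \<le> s" "ennreal s < ennreal T" using assms(1) by auto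
  then have "s \<le> T" by (meson ennreal_leI leD linorder_le_cases)
  then show "ennreal (norm (w s)) \<le> ennreal L"
    using s by (intro ennreal_leI assms) auto
qed

text \<open>Before the exit the first coordinate is positive and at most \<open>R\<close>, so the
  second component lies in a ball of radius \<open>A * R powr \<alpha>\<close>.\<close>

lemma snd_increment_small_before_exit:
  fixes w :: "real \<Rightarrow> real \<times> 'a::euclidean_space"
  assumes "0 < \<alpha>" "0 < A" and w0: "w 0 \<in> parabola_region A \<alpha>"
    and R: "exit_max (parabola_region A \<alpha>) w \<le> ennreal R" "0 \<le> R"
    and s: "0 \<le> s" "ennreal s < exit_time (parabola_region A \<alpha>) w"
    and t: "0 \<le> t" "ennreal t < exit_time (parabola_region A \<alpha>) w"
    and e: "e \<in> Basis"
  shows "\<bar>(w t - w s) \<bullet> (0, e)\<bar> \<le> 2 * (A * R powr \<alpha>)"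
proof -
  have *: "norm (snd (w t)) \<le> A * R powr \<alpha>"
    if t: "0 \<le> t" "ennreal t < exit_time (parabola_region A \<alpha>) w" for t
  proof -
    \<comment> \<open>The exit time looks only at positive times, so time 0 relies on
      \<open>w0\<close>.\<close>
    have "w t \<in> parabola_region A \<alpha>"
      using w0 in_domain_before_exit[of t] t by (cases "t = 0") auto
    then have D: "0 < fst (w t)" "norm (snd (w t)) < A * fst (w t) powr \<alpha>"
      by (auto simp: parabola_region_def split: prod.splits)
    have "ennreal (norm (w t)) \<le> ennreal R"
      using norm_le_exit_max[OF t] R(1) by (rule order_trans)
    then have "norm (w t) \<le> R" using R by simp
    moreover have "fst (w t) \<le> norm (w t)"
      using norm_fst_le[of "fst (w t)" "snd (w t)"] by simp
    ultimately have "fst (w t) powr \<alpha> \<le> R powr \<alpha>"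
      using D assms by (intro powr_mono2) auto
    then have "A * fst (w t) powr \<alpha> \<le> A * R powr \<alpha>"
      using assms by (intro mult_left_mono) auto
    then show ?thesis using D by simp
  qed
  have "\<bar>(w t - w s) \<bullet> (0, e)\<bar> = \<bar>(snd (w t) - snd (w s)) \<bullet> e\<bar>"
    by (simp add: inner_prod_def)
  also have "\<dots> \<le> norm (snd (w t) - snd (w s))"
    using Basis_le_norm[OF e] .
  also have "\<dots> \<le> norm (snd (w t)) + norm (snd (w s))"
    by (rule norm_triangle_ineq4)
  finally show ?thesis using *[OF s] *[OF t] by linarith
qed

section \<open>From the maximum to the exit time\<close>

text \<open>A finite exit time in \<open>(n, n + 1]\<close> either satisfies
  \<open>\<tau> powr \<beta> \<le> m\<close>, and then the first functional dominates, or the path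
  stays within distance \<open>(n + 1) powr \<beta>\<close> of the origin before exit and lies in
  the confinement event \<open>G n\<close>.\<close>

lemma exit_time_moment_if_exit_max_moment:
  fixes B :: "real \<Rightarrow> 'w \<Rightarrow> real \<times> 'a::euclidean_space"
  assumes \<alpha>: "0 < \<alpha>" "\<alpha> < 1" and A: "0 < A" and z: "z \<in> parabola_region A \<alpha>"
    and bm: "brownian_motion M B z" and b1: "0 < b1"
    and fin: "(\<integral>\<^sup>+\<omega>. enn_exp (ennreal b1 *
              enn_powr (exit_max (parabola_region A \<alpha>) (\<lambda>t. B t \<omega>)) (1 - \<alpha>)) \<partial>M) < \<infinity>"
  shows "\<exists>b2>0. (\<integral>\<^sup>+\<omega>. enn_exp (ennreal b2 *
              enn_powr (exit_time (parabola_region A \<alpha>) (\<lambda>t. B t \<omega>)) ((1 - \<alpha>) / (1 + \<alpha>))) \<partial>M) < \<infinity>"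
proof -
  interpret brownian_motion M B z by (rule bm)
  obtain e :: 'a where e: "e \<in> Basis" using nonempty_Basis by blast
  let ?D = "parabola_region A \<alpha> :: (real \<times> 'a) set"
  define \<beta> where "\<beta> = 1 / (1 + \<alpha>)"
  define \<kappa> where "\<kappa> = (1 - \<alpha>) / (1 + \<alpha>)"
  have \<beta>: "0 < \<beta>" and \<kappa>: "0 < \<kappa>" and \<beta>\<kappa>: "\<beta> * (1 - \<alpha>) = \<kappa>"
    and \<alpha>\<beta>: "(1 + \<alpha>) * \<beta> = 1"
    using \<alpha> by (auto simp: \<beta>_def \<kappa>_def)
  \<comment> \<open>Makes \<open>(n + 1) / (r n)\<^sup>2\<close> a multiple of
    \<open>(n + 1) powr \<kappa>\<close>, the order of the number of confinement periods.\<close>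
  then have exponents: "\<kappa> + \<beta> * \<alpha> * 2 = 1"
    by (simp add: algebra_simps flip: \<beta>\<kappa>)
  define r where "r n = A * ((real n + 1) powr \<beta>) powr \<alpha>" for n :: nat
  have r: "0 < r n" for n using A by (simp add: r_def)
  \<comment> \<open>The number of complete periods that fit into the time up to
    \<open>n\<close>.\<close>
  define k where "k n = nat \<lfloor>real n / (16 * (r n)\<^sup>2)\<rfloor>" for n
  define G where "G n = {\<omega>\<in>space M. \<forall>i<k n.
      \<bar>(B (16 * (r n)\<^sup>2 * real (Suc i)) \<omega> - B (16 * (r n)\<^sup>2 * real i) \<omega>) \<bullet> (0, e)\<bar> \<le> 2 * r n}" for n
  have e0: "(0::real, e) \<in> Basis" using e by (simp add: Basis_prod_def)
  have G[measurable]: "G n \<in> events" and pG: "prob (G n) \<le> (1 / 2) ^ k n" for n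
    unfolding G_def by (rule coordinate_increments_small[OF r e0])+
  \<comment> \<open>\<open>d\<close> is the decay rate of \<open>(1 / 2) ^ k n\<close> in
    \<open>(n + 1) powr \<kappa>\<close>. Taking \<open>b\<close> at most \<open>d / 2\<close>
    leaves half of this decay for summability, and \<open>b \<le> b1\<close> allows comparison with
    the given functional.\<close>
  define d where "d = ln 2 / (16 * A\<^sup>2)"
  define b where "b = min b1 (d / 2)"
  have d: "0 < d" and b: "0 < b" "b \<le> b1" "b \<le> d / 2"
    using A b1 by (auto simp: d_def b_def)
  define w where "w n = exp (b * (real n + 1) powr \<kappa>)" for n :: nat
  \<comment> \<open>\<open>ln 2\<close> pays for the rounding in \<open>k n\<close>, and
    \<open>d\<close> for having \<open>n\<close> instead of \<open>n + 1\<close> in it.\<close>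
  define C where "C = exp (ln 2 + d)"
  have half: "(1 / 2) ^ k n \<le> C * exp (- (d * (real n + 1) powr \<kappa>))" for n
  proof -
    have r2: "(r n)\<^sup>2 = A\<^sup>2 * (real n + 1) powr (\<beta> * \<alpha> * 2)"
      by (simp add: r_def power_mult_distrib powr_powr power2_eq_square mult_ac flip: powr_add)
    have "(real n + 1) = (real n + 1) powr \<kappa> * (real n + 1) powr (\<beta> * \<alpha> * 2)"
      unfolding powr_add[symmetric] exponents by simp
    then have "(real n + 1) / (16 * (r n)\<^sup>2) =
        (real n + 1) powr \<kappa> * (real n + 1) powr (\<beta> * \<alpha> * 2) / (16 * (r n)\<^sup>2)"
      by (rule arg_cong)
    then have 1: "(real n + 1) / (16 * (r n)\<^sup>2) = (real n + 1) powr \<kappa> / (16 * A\<^sup>2)"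
      unfolding r2 by simp
    have "1 \<le> (real n + 1) powr (\<beta> * \<alpha> * 2)"
      using \<beta> \<alpha> by (intro ge_one_powr_ge_zero) auto
    then have "1 / (16 * (r n)\<^sup>2) \<le> 1 / (16 * A\<^sup>2)"
      unfolding r2 using A by (intro divide_left_mono) auto
    then have "(real n + 1) powr \<kappa> / (16 * A\<^sup>2) - 1 / (16 * A\<^sup>2) \<le> real n / (16 * (r n)\<^sup>2)"
      unfolding 1[symmetric] by (simp add: add_divide_distrib)
    moreover have "real n / (16 * (r n)\<^sup>2) \<le> real (k n) + 1"
      unfolding k_def by linarith
    ultimately have "(real n + 1) powr \<kappa> / (16 * A\<^sup>2) - 1 / (16 * A\<^sup>2) - 1 \<le> real (k n)"
      by linarith
    then have "ln 2 * ((real n + 1) powr \<kappa> / (16 * A\<^sup>2) - 1 / (16 * A\<^sup>2) - 1) \<le> ln 2 * real (k n)"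
      by (intro mult_left_mono) auto
    then have "d * (real n + 1) powr \<kappa> - d - ln 2 \<le> ln 2 * real (k n)"
      by (simp add: d_def algebra_simps)
    then have "exp (- (ln 2 * real (k n))) \<le> exp (ln 2 + d + - (d * (real n + 1) powr \<kappa>))"
      by simp
    moreover have "exp (- (ln 2 * real (k n))) = (1 / 2) ^ k n"
      by (simp add: exp_minus mult.commute[of "ln 2"] exp_of_nat_mult power_one_over inverse_eq_divide)
    ultimately show ?thesis unfolding C_def exp_add[symmetric] by simp
  qed
  have sum: "summable (\<lambda>n. w n * prob (G n))"
  proof (rule summable_comparison_test)
    show "summable (\<lambda>n. C * exp (- (d / 2) * (real n + 1) powr \<kappa>))"
      using d \<kappa> by (intro summable_mult summable_exp_neg_powr) auto
    have "norm (w n * prob (G n)) \<le> C * exp (- (d / 2) * (real n + 1) powr \<kappa>)" for n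
    proof -
      have "w n \<le> exp (d / 2 * (real n + 1) powr \<kappa>)"
        using b by (auto simp: w_def intro!: mult_right_mono)
      then have "w n * prob (G n) \<le>
          exp (d / 2 * (real n + 1) powr \<kappa>) * (C * exp (- (d * (real n + 1) powr \<kappa>)))"
        using order_trans[OF pG half] by (intro mult_mono) (auto simp: w_def)
      also have "\<dots> = C * exp (d / 2 * (real n + 1) powr \<kappa> + - (d * (real n + 1) powr \<kappa>))"
        unfolding exp_add by simp
      also have "d / 2 * (real n + 1) powr \<kappa> + - (d * (real n + 1) powr \<kappa>) = - (d / 2) * (real n + 1) powr \<kappa>"
        by simp
      finally show ?thesis by (simp add: w_def)
    qed
    then show "\<exists>N. \<forall>n\<ge>N. norm (w n * prob (G n)) \<le> C * exp (- (d / 2) * (real n + 1) powr \<kappa>)"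
      by blast
  qed
  have "(\<integral>\<^sup>+\<omega>. enn_exp (ennreal b * enn_powr (exit_time ?D (\<lambda>t. B t \<omega>)) \<kappa>) \<partial>M) < \<infinity>"
  proof (rule nn_integral_finite_if_exceptional_events[OF G _ sum fin, where c = 0])
    show "AE \<omega> in M. enn_exp (ennreal b * enn_powr (exit_time ?D (\<lambda>t. B t \<omega>)) \<kappa>)
      \<le> enn_exp (ennreal b1 * enn_powr (exit_max ?D (\<lambda>t. B t \<omega>)) (1 - \<alpha>)) +
         (ennreal 0 + (\<Sum>n. ennreal (w n) * indicator (G n) \<omega>))"
      using start AE_space
    proof eventually_elim
      case (elim \<omega>)
      define \<tau> where "\<tau> = exit_time ?D (\<lambda>t. B t \<omega>)"
      define m where "m = exit_max ?D (\<lambda>t. B t \<omega>)"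
      have in_G: "\<omega> \<in> G n" if n: "ennreal (real n) < \<tau>" "m \<le> ennreal ((real n + 1) powr \<beta>)" for n
      proof -
        \<comment> \<open>All \<open>k n\<close> periods end by time \<open>n\<close>, which is
          before the exit.\<close>
        have before: "ennreal (16 * (r n)\<^sup>2 * real j) < \<tau>" if "j \<le> k n" for j
        proof -
          have "real j \<le> real n / (16 * (r n)\<^sup>2)"
            using that unfolding k_def by (simp add: le_nat_floor le_nat_iff le_floor_iff)
          then have "16 * (r n)\<^sup>2 * real j \<le> real n"
            using r[of n] by (simp add: field_simps)
          then show ?thesis using n(1) by (meson ennreal_leI order_le_less_trans)
        qed
        show ?thesis
          unfolding G_def r_def[of n, symmetric]
        proof (intro CollectI conjI allI impI)
          fix i assume i: "i < k n"
          show "\<bar>(B (16 * (r n)\<^sup>2 * real (Suc i)) \<omega> - B (16 * (r n)\<^sup>2 * real i) \<omega>) \<bullet> (0, e)\<bar> \<le> 2 * r n"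
            unfolding r_def[of n]
          proof (rule snd_increment_small_before_exit[where w = "\<lambda>t. B t \<omega>", OF \<alpha>(1) A _ _ _ _ _ _ _ e],
              unfold r_def[of n, symmetric] \<tau>_def[symmetric] m_def[symmetric])
            show "ennreal (16 * (r n)\<^sup>2 * real i) < \<tau>" "ennreal (16 * (r n)\<^sup>2 * real (Suc i)) < \<tau>"
              using before i by (simp_all del: of_nat_Suc)
          qed (use elim z n in auto)
        qed (use elim in simp)
      qed
      have w_le: "ennreal (w n) \<le> (\<Sum>n. ennreal (w n) * indicator (G n) \<omega>)" if "\<omega> \<in> G n" for n
        using suminf_ge_term_ennreal[of "\<lambda>n. ennreal (w n) * indicator (G n) \<omega>" n] that by simp
      have "enn_exp (ennreal b * enn_powr \<tau> \<kappa>)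
         \<le> enn_exp (ennreal b1 * enn_powr m (1 - \<alpha>)) + (\<Sum>n. ennreal (w n) * indicator (G n) \<omega>)"
      proof (cases m)
        case top
        then show ?thesis using enn_exp_mult_powr_top[OF b1] by simp
      next
        case m: (real x)
        show ?thesis
        proof (cases \<tau>)
          case top
          \<comment> \<open>From this index on \<open>(n + 1) powr \<beta>\<close> is at least
            \<open>x\<close>, and \<open>\<tau> = \<infinity>\<close> exceeds every
            \<open>n\<close>, so the path lies in \<open>G n\<close>.\<close>
          have "1 \<le> ennreal (w n) * indicator (G n) \<omega>" if n: "nat \<lceil>x powr (1 + \<alpha>)\<rceil> \<le> n" for n
          proof -
            have "x powr (1 + \<alpha>) \<le> real n + 1" using n by linarith
            then have "(x powr (1 + \<alpha>)) powr \<beta> \<le> (real n + 1) powr \<beta>"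
              using \<beta> by (intro powr_mono2) auto
            then have "x \<le> (real n + 1) powr \<beta>"
              using m by (simp add: powr_powr \<alpha>\<beta>)
            then have "\<omega> \<in> G n"
              using top m by (intro in_G) (auto intro!: ennreal_leI)
            then show ?thesis using b by (simp add: w_def)
          qed
          then have "(\<Sum>n. ennreal (w n) * indicator (G n) \<omega>) = \<infinity>"
            by (rule suminf_ennreal_eq_top_if_eventually_ge_1)
          then show ?thesis by simp
        next
          case \<tau>: (real t)
          have lhs: "enn_exp (ennreal b * enn_powr \<tau> \<kappa>) = ennreal (exp (b * t powr \<kappa>))"
            using \<tau> b by (simp add: enn_exp_mult_powr)
          show ?thesis
          proof (cases "t powr \<beta> \<le> x")
            case True
            then have "(t powr \<beta>) powr (1 - \<alpha>) \<le> x powr (1 - \<alpha>)"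
              using \<alpha> by (intro powr_mono2) auto
            then have "b * t powr \<kappa> \<le> b1 * x powr (1 - \<alpha>)"
              using b by (intro mult_mono) (auto simp: powr_powr \<beta>\<kappa>)
            then have "ennreal (exp (b * t powr \<kappa>)) \<le> enn_exp (ennreal b1 * enn_powr m (1 - \<alpha>))"
              using m b1 by (simp add: enn_exp_mult_powr)
            then show ?thesis unfolding lhs by (rule add_increasing2[rotated]) simp
          next
            case False
            then have t: "0 < t" using \<tau> m by (cases "t = 0") auto
            \<comment> \<open>The ceiling minus one, not the floor: \<open>in_G\<close> asks for the
              strict inequality \<open>n < \<tau>\<close>.\<close>
            define n where "n = nat (\<lceil>t\<rceil> - 1)"
            have n: "real n < t" "t \<le> real n + 1" using t unfolding n_def by linarith+
            have "t powr \<beta> \<le> (real n + 1) powr \<beta>"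
              using n t \<beta> by (intro powr_mono2) auto
            then have "\<omega> \<in> G n"
              using False n \<tau> m by (intro in_G) (auto intro!: ennreal_leI simp: ennreal_less_iff)
            have "t powr \<kappa> \<le> (real n + 1) powr \<kappa>"
              using n t \<kappa> by (intro powr_mono2) auto
            then have "ennreal (exp (b * t powr \<kappa>)) \<le> ennreal (w n)"
              unfolding w_def using b by (intro ennreal_leI) simp
            also note w_le[OF \<open>\<omega> \<in> G n\<close>]
            finally show ?thesis unfolding lhs by (rule add_increasing[rotated]) simp
          qed
        qed
      qed
      then show ?case by (simp add: \<tau>_def m_def)
    qed
  qed (simp add: w_def)
  then show ?thesis
    using b unfolding \<kappa>_def by blast
qed

section \<open>From the exit time to the maximum\<close>

text \<open>The integer scale is now spatial. If \<open>m\<close> lies in \<open>[n, n + 1)\<close>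
  and exceeds \<open>\<tau> powr \<beta>\<close>, then \<open>\<tau> \<le> T n\<close>; for
  \<open>n\<close> large compared with \<open>norm z\<close> the path must leave the ball of radius
  \<open>R n\<close> about \<open>z\<close> by time \<open>T n\<close>, which almost surely forces
  it into \<open>E n\<close>.\<close>

lemma exit_max_moment_if_exit_time_moment:
  fixes B :: "real \<Rightarrow> 'w \<Rightarrow> 'b::euclidean_space"
  assumes \<alpha>: "0 < \<alpha>" "\<alpha> < 1"
    and bm: "brownian_motion M B z" and b2: "0 < b2"
    and fin: "(\<integral>\<^sup>+\<omega>. enn_exp (ennreal b2 *
              enn_powr (exit_time D (\<lambda>t. B t \<omega>)) ((1 - \<alpha>) / (1 + \<alpha>))) \<partial>M) < \<infinity>"
  shows "\<exists>b1>0. (\<integral>\<^sup>+\<omega>. enn_exp (ennreal b1 *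
              enn_powr (exit_max D (\<lambda>t. B t \<omega>)) (1 - \<alpha>)) \<partial>M) < \<infinity>"
proof -
  interpret brownian_motion M B z by (rule bm)
  define \<beta> where "\<beta> = 1 / (1 + \<alpha>)"
  define \<kappa> where "\<kappa> = (1 - \<alpha>) / (1 + \<alpha>)"
  define p where "p = 1 - \<alpha>"
  have \<beta>: "0 < \<beta>" and p: "0 < p" and \<beta>\<kappa>: "\<beta> * p = \<kappa>" and \<alpha>\<beta>: "\<beta> * (1 + \<alpha>) = 1"
    using \<alpha> by (auto simp: \<beta>_def \<kappa>_def p_def field_simps)
  define T where "T n = (real n + 1) powr (1 + \<alpha>)" for n :: nat
  define R where "R n = (real n + 1) / 4" for n :: nat
  define C where "C = 2 * sqrt 2 ^ DIM('b) + exp 16"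
  \<comment> \<open>\<open>1024 = 16 * 64\<close>: the squared 4 of \<open>R n\<close> times the 64
    of the displacement bound.\<close>
  define c where "c = (1 / 1024 :: real)"
  have "\<forall>n. \<exists>E\<in>events. prob E \<le> C * exp (- ((R n)\<^sup>2 / (64 * T n))) \<and>
    (AE \<omega> in M. \<omega> \<notin> E \<longrightarrow> (\<forall>s\<in>{0..T n}. norm (B s \<omega> - z) \<le> R n))"
    unfolding C_def by (intro allI maximal_displacement_tail) (auto simp: T_def R_def)
  then obtain E where "\<forall>n. E n \<in> events \<and> prob (E n) \<le> C * exp (- ((R n)\<^sup>2 / (64 * T n))) \<and>
    (AE \<omega> in M. \<omega> \<notin> E n \<longrightarrow> (\<forall>s\<in>{0..T n}. norm (B s \<omega> - z) \<le> R n))"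
    unfolding Bex_def by (rule exE[OF choice])
  then have E: "\<And>n. E n \<in> events"
    and pE: "\<And>n. prob (E n) \<le> C * exp (- ((R n)\<^sup>2 / (64 * T n)))"
    and disp: "\<And>n. AE \<omega> in M. \<omega> \<notin> E n \<longrightarrow> (\<forall>s\<in>{0..T n}. norm (B s \<omega> - z) \<le> R n)"
    by blast+
  have ratio: "(R n)\<^sup>2 / (64 * T n) = c * (real n + 1) powr p" for n
  proof -
    have "(real n + 1) powr p * T n = (real n + 1) powr 2"
      unfolding T_def powr_add[symmetric] p_def by simp
    also have "\<dots> = (real n + 1)\<^sup>2" by (simp add: powr_numeral)
    finally have "(R n)\<^sup>2 = (real n + 1) powr p * T n / 16"
      by (simp add: R_def power_divide)
    moreover have "0 < T n" by (simp add: T_def)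
    ultimately show ?thesis by (simp add: c_def field_simps)
  qed
  define b where "b = min b2 (c / 2)"
  have c: "0 < c" and b: "0 < b" "b \<le> b2" "b \<le> c / 2"
    using b2 by (auto simp: b_def c_def)
  define w where "w n = exp (b * (real n + 1) powr p)" for n :: nat
  have sum: "summable (\<lambda>n. w n * prob (E n))"
  proof (rule summable_comparison_test)
    show "summable (\<lambda>n. C * exp (- (c / 2) * (real n + 1) powr p))"
      using c p by (intro summable_mult summable_exp_neg_powr) auto
    have "norm (w n * prob (E n)) \<le> C * exp (- (c / 2) * (real n + 1) powr p)" for n
    proof -
      have "w n \<le> exp (c / 2 * (real n + 1) powr p)"
        using b by (auto simp: w_def intro!: mult_right_mono)
      then have "w n * prob (E n) \<le>
          exp (c / 2 * (real n + 1) powr p) * (C * exp (- (c * (real n + 1) powr p)))"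
        using pE[of n, unfolded ratio] by (intro mult_mono) (auto simp: w_def)
      also have "\<dots> = C * exp (c / 2 * (real n + 1) powr p + - (c * (real n + 1) powr p))"
        unfolding exp_add by simp
      also have "c / 2 * (real n + 1) powr p + - (c * (real n + 1) powr p) = - (c / 2) * (real n + 1) powr p"
        by simp
      finally show ?thesis by (simp add: w_def)
    qed
    then show "\<exists>N. \<forall>n\<ge>N. norm (w n * prob (E n)) \<le> C * exp (- (c / 2) * (real n + 1) powr p)"
      by blast
  qed
  \<comment> \<open>Covers the small scales \<open>n \<le> 2 * norm z + 1\<close>, where the maximum
    is at most \<open>n + 1\<close> and the starting point alone may account for it.\<close>
  define c0 where "c0 = exp (b * (2 * norm z + 2) powr p)"
  have "(\<integral>\<^sup>+\<omega>. enn_exp (ennreal b * enn_powr (exit_max D (\<lambda>t. B t \<omega>)) p) \<partial>M) < \<infinity>"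
  proof (rule nn_integral_finite_if_exceptional_events[OF E _ sum fin, where c = c0])
    have "AE \<omega> in M. \<forall>n. \<omega> \<notin> E n \<longrightarrow> (\<forall>s\<in>{0..T n}. norm (B s \<omega> - z) \<le> R n)"
      using disp by (simp add: AE_all_countable)
    then show "AE \<omega> in M. enn_exp (ennreal b * enn_powr (exit_max D (\<lambda>t. B t \<omega>)) p)
      \<le> enn_exp (ennreal b2 * enn_powr (exit_time D (\<lambda>t. B t \<omega>)) ((1 - \<alpha>) / (1 + \<alpha>))) +
         (ennreal c0 + (\<Sum>n. ennreal (w n) * indicator (E n) \<omega>))"
    proof eventually_elim
      case (elim \<omega>)
      define \<tau> where "\<tau> = exit_time D (\<lambda>t. B t \<omega>)"
      define m where "m = exit_max D (\<lambda>t. B t \<omega>)"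
      have in_E: "\<omega> \<in> E n"
        if n: "2 * norm z + 1 < real n" "ennreal (real n) \<le> m" "\<tau> \<le> ennreal (T n)" for n
      proof (rule ccontr)
        assume "\<omega> \<notin> E n"
        with elim have d: "norm (B s \<omega> - z) \<le> R n" if "s \<in> {0..T n}" for s
          using that by blast
        have "norm (B s \<omega>) \<le> R n + norm z" if "s \<in> {0..T n}" for s
          using d[OF that] norm_triangle_ineq[of "B s \<omega> - z" z] by simp
        then have "m \<le> ennreal (R n + norm z)"
          using n(3) unfolding m_def \<tau>_def by (intro exit_max_le) auto
        with n(2) have "ennreal (real n) \<le> ennreal (R n + norm z)"
          by (rule order_trans)
        then have "real n \<le> R n + norm z"
          by (subst (asm) ennreal_le_iff) (auto simp: R_def)
        \<comment> \<open>With \<open>norm z < (n - 1) / 2\<close>, the right-hand side is below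
          \<open>(n + 1) / 4 + (n - 1) / 2 < n\<close>.\<close>
        then show False
          using n(1) norm_ge_zero[of z] by (simp add: R_def field_simps)
      qed
      have w_le: "ennreal (w n) \<le> (\<Sum>n. ennreal (w n) * indicator (E n) \<omega>)" if "\<omega> \<in> E n" for n
        using suminf_ge_term_ennreal[of "\<lambda>n. ennreal (w n) * indicator (E n) \<omega>" n] that by simp
      have "enn_exp (ennreal b * enn_powr m p)
         \<le> enn_exp (ennreal b2 * enn_powr \<tau> \<kappa>) + (ennreal c0 + (\<Sum>n. ennreal (w n) * indicator (E n) \<omega>))"
      proof (cases \<tau>)
        case top
        then show ?thesis using enn_exp_mult_powr_top[OF b2] by simp
      next
        case \<tau>: (real t)
        show ?thesis
        proof (cases m)
          case top
          \<comment> \<open>The first threshold ensures \<open>t \<le> T n\<close>, the second that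
            \<open>n\<close> is beyond the small scales, as \<open>in_E\<close> requires.\<close>
          have "1 \<le> ennreal (w n) * indicator (E n) \<omega>"
            if n: "max (nat \<lceil>t powr \<beta>\<rceil>) (nat \<lceil>2 * norm z + 2\<rceil>) \<le> n" for n
          proof -
            have "t powr \<beta> \<le> real n + 1" "2 * norm z + 1 < real n" using n by linarith+
            then have "(t powr \<beta>) powr (1 + \<alpha>) \<le> T n"
              unfolding T_def using \<alpha> by (intro powr_mono2) auto
            then have "t \<le> T n"
              using \<tau> by (simp add: powr_powr \<alpha>\<beta>)
            then have "\<omega> \<in> E n"
              using \<open>2 * norm z + 1 < real n\<close> top \<tau> by (intro in_E) (auto intro!: ennreal_leI)
            then show ?thesis using b by (simp add: w_def)
          qed
          then have "(\<Sum>n. ennreal (w n) * indicator (E n) \<omega>) = \<infinity>"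
            by (rule suminf_ennreal_eq_top_if_eventually_ge_1)
          then show ?thesis by simp
        next
          case m: (real x)
          have lhs: "enn_exp (ennreal b * enn_powr m p) = ennreal (exp (b * x powr p))"
            using m b by (simp add: enn_exp_mult_powr)
          show ?thesis
          proof (cases "x \<le> t powr \<beta>")
            case True
            then have "x powr p \<le> (t powr \<beta>) powr p"
              using p m by (intro powr_mono2) auto
            then have "b * x powr p \<le> b2 * t powr \<kappa>"
              using b by (intro mult_mono) (auto simp: powr_powr \<beta>\<kappa>)
            then have "ennreal (exp (b * x powr p)) \<le> enn_exp (ennreal b2 * enn_powr \<tau> \<kappa>)"
              using \<tau> b2 by (simp add: enn_exp_mult_powr)
            then show ?thesis unfolding lhs by (rule add_increasing2[rotated]) simp
          next
            case False
            \<comment> \<open>The floor suffices here, since \<open>in_E\<close> asks only for the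
              weak inequality \<open>n \<le> m\<close>.\<close>
            define n where "n = nat \<lfloor>x\<rfloor>"
            have n: "real n \<le> x" "x \<le> real n + 1" using m unfolding n_def by linarith+
            have "(t powr \<beta>) powr (1 + \<alpha>) \<le> T n"
              unfolding T_def using False n \<alpha> by (intro powr_mono2) auto
            then have t: "t \<le> T n"
              using \<tau> by (simp add: powr_powr \<alpha>\<beta>)
            show ?thesis
            proof (cases "2 * norm z + 1 < real n")
              case True
              then have "\<omega> \<in> E n"
                using n t \<tau> m by (intro in_E) (auto intro!: ennreal_leI)
              have "x powr p \<le> (real n + 1) powr p"
                using n m p by (intro powr_mono2) auto
              then have "ennreal (exp (b * x powr p)) \<le> ennreal (w n)"
                unfolding w_def using b by (intro ennreal_leI) simp
              also note w_le[OF \<open>\<omega> \<in> E n\<close>]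
              finally show ?thesis
                unfolding lhs by (intro add_increasing) auto
            next
              case False
              then have "x powr p \<le> (2 * norm z + 2) powr p"
                using n m p by (intro powr_mono2) auto
              then have "ennreal (exp (b * x powr p)) \<le> ennreal c0"
                unfolding c0_def using b by (intro ennreal_leI) simp
              then show ?thesis
                unfolding lhs by (intro add_increasing add_increasing2) auto
            qed
          qed
        qed
      qed
      then show ?case by (simp add: \<tau>_def m_def \<kappa>_def)
    qed
  qed (simp add: w_def)
  then show ?thesis
    using b unfolding p_def by blast
qed

theorem theorem4:
  fixes M :: "'w measure"
    and B :: "real \<Rightarrow> 'w \<Rightarrow> real \<times> 'a::euclidean_space"
    and z :: "real \<times> 'a"
    and A \<alpha> :: real
  assumes "0 < \<alpha>" and "\<alpha> < 1" and "0 < A"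
    and "z \<in> parabola_region A \<alpha>"
    and "brownian_motion M B z"
  shows "(\<exists>b1>0. (\<integral>\<^sup>+\<omega>. enn_exp (ennreal b1 *
              enn_powr (exit_max (parabola_region A \<alpha>) (\<lambda>t. B t \<omega>)) (1 - \<alpha>)) \<partial>M) < \<infinity>)
     \<longleftrightarrow> (\<exists>b2>0. (\<integral>\<^sup>+\<omega>. enn_exp (ennreal b2 *
              enn_powr (exit_time (parabola_region A \<alpha>) (\<lambda>t. B t \<omega>)) ((1 - \<alpha>) / (1 + \<alpha>))) \<partial>M) < \<infinity>)"
  using exit_time_moment_if_exit_max_moment[OF assms]
    exit_max_moment_if_exit_time_moment[OF assms(1,2,5)] by blast

end
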